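(* Let $f,g,c$ satisfy the standing assumption on the composite problem (P), $\min_x\Phi(x)=f(x)+g(c(x))$, and suppose that (P) possesses a stationary minimizer. Let $\{(x^k,z^k,y^k,\hat y^k)\}$ be a sequence generated by the safeguarded augmented Lagrangian method (described in the context) such that $\sum_{k=0}^\infty\sqrt{\varepsilon_k/\mu_k}<\infty$. Suppose that either $\mu_k\to0$ or $\Lambda\cap S\ne\emptyset$. Then $c(x^k)-z^k\to0$ and $$\limsup_{k\to\infty}\left(f(x^k)+g(z^k)\right)\le\Phi^\star .$$ Particularly, each accumulation point $\bar x\in\mathbb R^n$ of $\{x^k\}$ is a minimizer of (P). For each subsequence $\{x^k\}_{k\in K}$ ($K\subseteq\mathbb N$ infinite) converging to some $\bar x$, one has $z^k\to c(\bar x)$ and $f(x^k)+g(z^k)\to\Phi^\star$ as $k\to\infty$, $k\in K$.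
   Context: Spaces $\mathbb R^n,\mathbb R^m$ carry the Euclidean inner product $\langle\cdot,\cdot\rangle$ and norm $\|\cdot\|$; $\overline{\mathbb R}=\mathbb R\cup\{+\infty\}$. For a proper lsc convex $g:\mathbb R^m\to\overline{\mathbb R}$, the horizon is $\operatorname{hzn} g=\{v\in\mathbb R^m : g(z+v)\le g(z)\ \forall z\in\operatorname{dom} g\}$. Standing assumption: $f:\mathbb R^n\to\mathbb R$ is continuously differentiable and convex; $g:\mathbb R^m\to\overline{\mathbb R}$ is proper, lsc, convex; $c:\mathbb R^n\to\mathbb R^m$ is continuously differentiable and $(-\operatorname{hzn} g)$-convex, i.e. $c(\lambda x+(1-\lambda)x')-\lambda c(x)-(1-\lambda)c(x')\in\operatorname{hzn} g$ for all $x,x'\in\mathbb R^n$, $\lambda\in[0,1]$; (P) is feasible and possesses a minimizer, with minimal value $\Phi^\star$. A feasible point $\bar x$ is stationary if there is $\bar y\in\partial g(c(\bar x))$ with $\nabla f(\bar x)+c'(\bar x)^\top\bar y=0$; the set of all such $\bar y$ (multipliers) is $\Lambda(\bar x)$. If (P) has a stationary minimizer, all minimizers of (P) are stationary and share the same multiplier set, denoted $\Lambda$. Augmented Lagrangian for $\mu>0$: $L_\mu(x,y)=f(x)+g^\mu(c(x)+\mu y)-\frac\mu2\|y\|^2$, where $g^\mu(z)=\inf_w\{g(w)+\frac1{2\mu}\|w-z\|^2\}$. $\operatorname{prox}_\varphi(z)$ is the unique minimizer of $w\mapsto\varphi(w)+\frac12\|w-z\|^2$; $\operatorname{proj}_S$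 is the Euclidean projection onto $S$. Safeguarded ALM. Data: $y^0\in\mathbb R^m$; $\mu_0>0$; nonempty, convex, compact set $S\subseteq\mathbb R^m$; $\beta\in(0,1)$. For $k=0,1,2,\dots$: set $\hat y^k=\operatorname{proj}_S(y^k)$; select $\varepsilon_k\ge0$ and $x^k\in\mathbb R^n$ with $L_{\mu_k}(x^k,\hat y^k)\le\inf_xL_{\mu_k}(x,\hat y^k)+\varepsilon_k$; set $z^k=\operatorname{prox}_{\mu_kg}(c(x^k)+\mu_k\hat y^k)$; set $y^{k+1}=\hat y^k+\mu_k^{-1}(c(x^k)-z^k)$; set $\mu_{k+1}=\beta_k\mu_k$ for some $\beta_k\in(0,\beta]\cup\{1\}$. *)

theory Defs
  imports "HOL-Analysis.Analysis"
begin

section \<open>Convex analysis\<close>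

text \<open>Functions into $R \cup \{+\infty\}$ are modelled as \<^typ>\<open>ereal\<close>-valued functions; the
  value $-\infty$ is excluded by \<open>proper\<close>.\<close>

definition edom :: "('a \<Rightarrow> ereal) \<Rightarrow> 'a set" where
  "edom g = {z. g z < \<infinity>}"

definition proper :: "('a \<Rightarrow> ereal) \<Rightarrow> bool" where
  "proper g \<longleftrightarrow> (\<forall>z. g z \<noteq> -\<infinity>) \<and> edom g \<noteq> {}"

definition lsc :: "('a::topological_space \<Rightarrow> ereal) \<Rightarrow> bool" where
  "lsc g \<longleftrightarrow> (\<forall>z. g z \<le> Liminf (at z) g)"

text \<open>Since $0 \cdot \infty = 0$ for \<^typ>\<open>ereal\<close>, the endpoints of the segment are harmless.\<close>

definition econvex :: "('a::real_vector \<Rightarrow> ereal) \<Rightarrow> bool" where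
  "econvex g \<longleftrightarrow> (\<forall>z w. \<forall>t\<in>{0..1::real}.
     g (t *\<^sub>R z + (1 - t) *\<^sub>R w) \<le> ereal t * g z + ereal (1 - t) * g w)"

definition hzn :: "('a::real_vector \<Rightarrow> ereal) \<Rightarrow> 'a set" where
  "hzn g = {v. \<forall>z\<in>edom g. g (z + v) \<le> g z}"

definition subdifferential :: "('a::real_inner \<Rightarrow> ereal) \<Rightarrow> 'a \<Rightarrow> 'a set" where
  "subdifferential g z = {y. z \<in> edom g \<and> (\<forall>w. g z + ereal (y \<bullet> (w - z)) \<le> g w)}"

definition moreau :: "real \<Rightarrow> ('a::real_normed_vector \<Rightarrow> ereal) \<Rightarrow> 'a \<Rightarrow> ereal" where
  "moreau \<mu> g z = (INF w. g w + ereal (1 / (2 * \<mu>) * (norm (w - z))\<^sup>2))"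

definition prox :: "('a::real_normed_vector \<Rightarrow> ereal) \<Rightarrow> 'a \<Rightarrow> 'a" where
  "prox \<phi> z = (THE w. is_arg_min (\<lambda>w. \<phi> w + ereal (1 / 2 * (norm (w - z))\<^sup>2)) (\<lambda>_. True) w)"

definition gradient :: "('a::real_inner \<Rightarrow> real) \<Rightarrow> 'a \<Rightarrow> 'a" where
  "gradient f x = (THE D. GDERIV f x :> D)"

definition continuously_differentiable ::
    "('a::real_normed_vector \<Rightarrow> 'b::real_normed_vector) \<Rightarrow> bool" where
  "continuously_differentiable f \<longleftrightarrow>
     (\<exists>f'. (\<forall>x. (f has_derivative blinfun_apply (f' x)) (at x)) \<and> continuous_on UNIV f')"

section \<open>The composite problem\<close>

definition objective ::
    "('a \<Rightarrow> real) \<Rightarrow> ('b \<Rightarrow> ereal) \<Rightarrow> ('a \<Rightarrow> 'b) \<Rightarrow> 'a \<Rightarrow> ereal" where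
  "objective f g c x = ereal (f x) + g (c x)"

definition feasible :: "('b \<Rightarrow> ereal) \<Rightarrow> ('a \<Rightarrow> 'b) \<Rightarrow> 'a \<Rightarrow> bool" where
  "feasible g c x \<longleftrightarrow> c x \<in> edom g"

definition is_minimizer ::
    "('a \<Rightarrow> real) \<Rightarrow> ('b \<Rightarrow> ereal) \<Rightarrow> ('a \<Rightarrow> 'b) \<Rightarrow> 'a \<Rightarrow> bool" where
  "is_minimizer f g c x \<longleftrightarrow> is_arg_min (objective f g c) (feasible g c) x"

definition min_value :: "('a \<Rightarrow> real) \<Rightarrow> ('b \<Rightarrow> ereal) \<Rightarrow> ('a \<Rightarrow> 'b) \<Rightarrow> ereal" where
  "min_value f g c = (INF x. objective f g c x)"

definition composite_problem ::
    "(real^'n \<Rightarrow> real) \<Rightarrow> (real^'m \<Rightarrow> ereal) \<Rightarrow> (real^'n \<Rightarrow> real^'m) \<Rightarrow> bool" where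
  "composite_problem f g c \<longleftrightarrow>
     continuously_differentiable f \<and> convex_on UNIV f \<and>
     proper g \<and> lsc g \<and> econvex g \<and>
     continuously_differentiable c \<and>
     (\<forall>x x'. \<forall>t\<in>{0..1::real}.
        c (t *\<^sub>R x + (1 - t) *\<^sub>R x') - t *\<^sub>R c x - (1 - t) *\<^sub>R c x' \<in> hzn g) \<and>
     (\<exists>x. feasible g c x) \<and> (\<exists>x. is_minimizer f g c x)"

definition multipliers ::
    "(real^'n \<Rightarrow> real) \<Rightarrow> (real^'m \<Rightarrow> ereal) \<Rightarrow> (real^'n \<Rightarrow> real^'m) \<Rightarrow> real^'n \<Rightarrow> (real^'m) set" where
  "multipliers f g c x =
     {y. y \<in> subdifferential g (c x) \<and> gradient f x + transpose (jacobian c (at x)) *v y = 0}"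

definition stationary ::
    "(real^'n \<Rightarrow> real) \<Rightarrow> (real^'m \<Rightarrow> ereal) \<Rightarrow> (real^'n \<Rightarrow> real^'m) \<Rightarrow> real^'n \<Rightarrow> bool" where
  "stationary f g c x \<longleftrightarrow> feasible g c x \<and> multipliers f g c x \<noteq> {}"

text \<open>The multiplier set shared by all minimizers; lemma \<open>multiplier_set_eq\<close> below shows that it is
  well defined.\<close>

definition multiplier_set ::
    "(real^'n \<Rightarrow> real) \<Rightarrow> (real^'m \<Rightarrow> ereal) \<Rightarrow> (real^'n \<Rightarrow> real^'m) \<Rightarrow> (real^'m) set" where
  "multiplier_set f g c =
     (THE \<Lambda>. \<forall>x. is_minimizer f g c x \<longrightarrow> multipliers f g c x = \<Lambda>)"

section \<open>The safeguarded augmented Lagrangian method\<close>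

definition aug_lagrangian ::
    "('a \<Rightarrow> real) \<Rightarrow> ('b::real_normed_vector \<Rightarrow> ereal) \<Rightarrow> ('a \<Rightarrow> 'b) \<Rightarrow> real \<Rightarrow> 'a \<Rightarrow> 'b \<Rightarrow> ereal" where
  "aug_lagrangian f g c \<mu> x y =
     ereal (f x) + moreau \<mu> g (c x + \<mu> *\<^sub>R y) - ereal (\<mu> / 2 * (norm y)\<^sup>2)"

definition safeguarded_ALM ::
    "(real^'n \<Rightarrow> real) \<Rightarrow> (real^'m \<Rightarrow> ereal) \<Rightarrow> (real^'n \<Rightarrow> real^'m) \<Rightarrow>
     real^'m \<Rightarrow> real \<Rightarrow> (real^'m) set \<Rightarrow> real \<Rightarrow>
     (nat \<Rightarrow> real^'n) \<Rightarrow> (nat \<Rightarrow> real^'m) \<Rightarrow> (nat \<Rightarrow> real^'m) \<Rightarrow> (nat \<Rightarrow> real^'m) \<Rightarrow>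
     (nat \<Rightarrow> real) \<Rightarrow> (nat \<Rightarrow> real) \<Rightarrow> bool" where
  "safeguarded_ALM f g c y0 \<mu>0 S \<beta> x z y yhat \<epsilon> \<mu> \<longleftrightarrow>
     \<mu>0 > 0 \<and> S \<noteq> {} \<and> convex S \<and> compact S \<and> 0 < \<beta> \<and> \<beta> < 1 \<and>
     y 0 = y0 \<and> \<mu> 0 = \<mu>0 \<and>
     (\<forall>k. yhat k = closest_point S (y k) \<and>
          \<epsilon> k \<ge> 0 \<and>
          aug_lagrangian f g c (\<mu> k) (x k) (yhat k)
            \<le> (INF x'. aug_lagrangian f g c (\<mu> k) x' (yhat k)) + ereal (\<epsilon> k) \<and>
          z k = prox (\<lambda>w. ereal (\<mu> k) * g w) (c (x k) + \<mu> k *\<^sub>R yhat k) \<and>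
          y (Suc k) = yhat k + inverse (\<mu> k) *\<^sub>R (c (x k) - z k) \<and>
          (\<exists>b\<in>{0<..\<beta>} \<union> {1}. \<mu> (Suc k) = b * \<mu> k))"

section \<open>Well-definedness of the common multiplier set\<close>

lemma gradient_works:
  fixes f :: "real^'n \<Rightarrow> real"
  assumes "continuously_differentiable f"
  shows "(f has_derivative (\<lambda>h. h \<bullet> gradient f x)) (at x)"
proof -
  from assms obtain f' where f': "(f has_derivative f') (at x)"
    unfolding continuously_differentiable_def by blast
  then interpret f': bounded_linear f' by (rule has_derivative_bounded_linear)
  have lin: "linear f'" by (rule f'.linear)
  have eq: "f' = (\<lambda>h. h \<bullet> adjoint f' 1)"
    using adjoint_works[OF lin, of _ 1] by (auto simp: inner_real_def)
  have G: "GDERIV f x :> adjoint f' 1"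
    using f' eq unfolding gderiv_def by simp
  have U: "D = adjoint f' 1" if "GDERIV f x :> D" for D
  proof -
    have "(\<lambda>h. h \<bullet> D) = f'"
      using that f' unfolding gderiv_def by (rule has_derivative_unique)
    hence "h \<bullet> D = h \<bullet> adjoint f' 1" for h using eq by metis
    thus ?thesis by (metis vector_eq_rdot inner_commute)
  qed
  have "GDERIV f x :> gradient f x"
    unfolding gradient_def using G U by (rule theI[where P = "\<lambda>D. GDERIV f x :> D"])
  thus ?thesis unfolding gderiv_def .
qed

lemma multipliers_iff:
  fixes f :: "real^'n \<Rightarrow> real" and c :: "real^'n \<Rightarrow> real^'m"
  assumes P: "composite_problem f g c"
  shows "y \<in> multipliers f g c x \<longleftrightarrow>
    y \<in> subdifferential g (c x) \<and> (\<forall>x'. f x + y \<bullet> c x \<le> f x' + y \<bullet> c x')"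
proof (cases "y \<in> subdifferential g (c x)")
  case False
  thus ?thesis by (simp add: multipliers_def)
next
  case sub: True
  define \<phi> where "\<phi> = (\<lambda>x. f x + y \<bullet> c x)"
  define D where "D = gradient f x + transpose (jacobian c (at x)) *v y"
  have cdf: "continuously_differentiable f" and cvf: "convex_on UNIV f"
    and cdc: "continuously_differentiable c" and pr: "proper g"
    using P unfolding composite_problem_def by auto
  have y_hzn: "y \<bullet> v \<le> 0" if "v \<in> hzn g" for v
  proof -
    have fin: "g (c x) < \<infinity>" "g (c x) \<noteq> -\<infinity>"
      and "g (c x + v) \<le> g (c x)" "g (c x) + ereal (y \<bullet> v) \<le> g (c x + v)"
      using sub that pr unfolding subdifferential_def hzn_def edom_def proper_def
      by (auto dest: spec[of _ "c x + v"])
    hence "g (c x) + ereal (y \<bullet> v) \<le> g (c x)" by (meson order_trans)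
    thus ?thesis using fin by (cases "g (c x)") auto
  qed
  have conv: "convex_on UNIV \<phi>"
  proof (intro convex_onI)
    fix t :: real and a b :: "real^'n" assume t: "0 < t" "t < 1"
    let ?w = "(1 - t) *\<^sub>R a + t *\<^sub>R b"
    have "c (t *\<^sub>R b + (1 - t) *\<^sub>R a) - t *\<^sub>R c b - (1 - t) *\<^sub>R c a \<in> hzn g"
      using P t unfolding composite_problem_def by auto
    from y_hzn[OF this]
    have "y \<bullet> c ?w \<le> (1 - t) * (y \<bullet> c a) + t * (y \<bullet> c b)"
      by (simp add: inner_diff_right add.commute)
    moreover have "f ?w \<le> (1 - t) * f a + t * f b"
      using cvf t by (simp add: convex_on_def)
    ultimately show "\<phi> ?w \<le> (1 - t) * \<phi> a + t * \<phi> b"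
      by (simp add: \<phi>_def algebra_simps)
  qed simp
  have dc: "(c has_derivative (\<lambda>h. jacobian c (at x) *v h)) (at x)"
    using cdc jacobian_works[of c "at x"] unfolding continuously_differentiable_def differentiable_def
    by metis
  have "(\<phi> has_derivative (\<lambda>h. h \<bullet> gradient f x + y \<bullet> (jacobian c (at x) *v h))) (at x)"
    unfolding \<phi>_def by (intro has_derivative_add gradient_works cdf has_derivative_inner_right dc)
  moreover have "h \<bullet> gradient f x + y \<bullet> (jacobian c (at x) *v h) = h \<bullet> D" for h
    unfolding D_def inner_add_right
    by (metis dot_lmul_matrix inner_commute transpose_matrix_vector)
  ultimately have der: "(\<phi> has_derivative (\<lambda>h. h \<bullet> D)) (at x)" by simp
  have "D = 0 \<longleftrightarrow> (\<forall>x'. \<phi> x \<le> \<phi> x')"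
  proof
    assume min: "\<forall>x'. \<phi> x \<le> \<phi> x'"
    have "(\<lambda>h. h \<bullet> D) = (\<lambda>h. 0)"
      by (rule has_derivative_local_min[OF der]) (use min in auto)
    thus "D = 0" by (metis inner_eq_zero_iff)
  next
    assume D0: "D = 0"
    show "\<forall>x'. \<phi> x \<le> \<phi> x'"
    proof
      fix x'
      define \<psi> where "\<psi> = (\<lambda>t::real. \<phi> (x + t *\<^sub>R (x' - x)))"
      have d1: "((\<lambda>t::real. x + t *\<^sub>R (x' - x)) has_derivative (\<lambda>t. t *\<^sub>R (x' - x))) (at 0)"
        by (auto intro!: derivative_eq_intros)
      have d\<psi>: "(\<psi> has_real_derivative 0) (at 0)"
        using has_derivative_compose[OF d1, of \<phi> "\<lambda>h. h \<bullet> D"] der D0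
        by (simp add: \<psi>_def has_field_derivative_def lambda_zero)
      hence lim: "((\<lambda>t. (\<psi> t - \<psi> 0) / t) \<longlongrightarrow> 0) (at_right 0)"
        by (auto simp: has_field_derivative_iff intro: filterlim_mono at_le)
      have "\<forall>\<^sub>F t in at_right (0::real). (\<psi> t - \<psi> 0) / t \<le> \<phi> x' - \<phi> x"
      proof -
        have "(\<psi> t - \<psi> 0) / t \<le> \<phi> x' - \<phi> x" if "0 < t" "t < 1" for t
        proof -
          have "\<phi> ((1 - t) *\<^sub>R x + t *\<^sub>R x') \<le> (1 - t) * \<phi> x + t * \<phi> x'"
            using conv that by (simp add: convex_on_def)
          moreover have "(1 - t) *\<^sub>R x + t *\<^sub>R x' = x + t *\<^sub>R (x' - x)"
            by (simp add: algebra_simps)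
          ultimately show ?thesis using that by (simp add: \<psi>_def field_simps)
        qed
        thus ?thesis
          unfolding eventually_at_right_field by (intro exI[of _ 1]) auto
      qed
      from tendsto_upperbound[OF lim this] show "\<phi> x \<le> \<phi> x'" by simp
    qed
  qed
  thus ?thesis using sub by (simp add: multipliers_def D_def \<phi>_def)
qed

lemma multipliers_minimizer_mono:
  assumes P: "composite_problem f g c"
    and m1: "is_minimizer f g c x1" and m2: "is_minimizer f g c x2"
    and y: "y \<in> multipliers f g c x1"
  shows "y \<in> multipliers f g c x2"
proof -
  have pr: "proper g" using P by (simp add: composite_problem_def)
  from m1 m2 have "objective f g c x1 = objective f g c x2"
    and e: "g (c x1) < \<infinity>" "g (c x2) < \<infinity>"
    unfolding is_minimizer_def is_arg_min_linorder feasible_def edom_def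
    by (auto intro: antisym)
  with pr obtain a b where ab: "g (c x1) = ereal a" "g (c x2) = ereal b" "f x1 + a = f x2 + b"
    unfolding proper_def objective_def
    by (cases "g (c x1)"; cases "g (c x2)") auto
  have s: "g (c x1) + ereal (y \<bullet> (w - c x1)) \<le> g w" for w
    using y by (simp add: multipliers_def subdifferential_def)
  have mn: "f x1 + y \<bullet> c x1 \<le> f x' + y \<bullet> c x'" for x'
    using y multipliers_iff[OF P] by blast
  have le: "a + y \<bullet> (c x2 - c x1) \<le> b" using s[of "c x2"] ab by simp
  have "b = a + y \<bullet> (c x2 - c x1)" and eq: "f x1 + y \<bullet> c x1 = f x2 + y \<bullet> c x2"
    using le mn[of x2] ab(3) by (simp_all add: inner_diff_right)
  have "y \<in> subdifferential g (c x2)"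
    unfolding subdifferential_def edom_def mem_Collect_eq
  proof (intro conjI allI)
    fix w
    have "g (c x2) + ereal (y \<bullet> (w - c x2)) = g (c x1) + ereal (y \<bullet> (w - c x1))"
      using \<open>b = _\<close> ab by (simp add: inner_diff_right)
    thus "g (c x2) + ereal (y \<bullet> (w - c x2)) \<le> g w" using s by simp
  qed (use e in simp)
  thus ?thesis using mn eq multipliers_iff[OF P] by metis
qed

lemma multiplier_set_eq:
  assumes "composite_problem f g c" "is_minimizer f g c x"
  shows "multiplier_set f g c = multipliers f g c x"
  unfolding multiplier_set_def
proof (rule the_equality)
  show "\<forall>x'. is_minimizer f g c x' \<longrightarrow> multipliers f g c x' = multipliers f g c x"
    using multipliers_minimizer_mono[OF assms(1)] assms(2) by blast
qed (use assms(2) in blast)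

end

theory Submission
  imports Defs
begin

text \<open>Write \<open>r\<^sub>k = c (x\<^sub>k) - z\<^sub>k\<close>, so that \<open>y\<^bsub>k+1\<^esub> - yhat\<^sub>k = r\<^sub>k / \<mu>\<^sub>k\<close>. The map
  \<open>(x, w) \<mapsto> f x + g w\<close> is convex along perturbations of the constraint \<open>c x - w = 0\<close>, and
  minimizing the augmented Lagrangian over \<open>x\<close> amounts to minimizing
  \<open>f x + g w + yhat\<^sub>k \<bullet> (c x - w) + |c x - w|\<^sup>2 / (2 \<mu>\<^sub>k)\<close> jointly. Comparing the iterate with the
  midpoint of the iterate and \<open>(x*, c x*)\<close>, rather than with \<open>(x*, c x*)\<close> itself, gives for every
  multiplier \<open>p\<close> the estimate
  \<open>r\<^sub>k \<bullet> (yhat\<^sub>k - p) + 3/4 |r\<^sub>k|\<^sup>2 / \<mu>\<^sub>k \<le> 2 \<epsilon>\<^sub>k\<close>, whose constant exceeds 1/2.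
  If \<open>\<mu>\<^sub>k \<rightarrow> 0\<close>, boundedness of \<open>S\<close> yields \<open>r\<^sub>k \<rightarrow> 0\<close> at once. If \<open>p \<in> S\<close>, the excess over 1/2 and
  nonexpansiveness of the projection yield the descent
  \<open>|y\<^bsub>k+1\<^esub> - p|\<^sup>2 + |y\<^bsub>k+1\<^esub> - yhat\<^sub>k|\<^sup>2 / 2 \<le> |y\<^sub>k - p|\<^sup>2 + 4 \<epsilon>\<^sub>k / \<mu>\<^sub>k\<close>, so
  \<open>y\<^bsub>k+1\<^esub> - yhat\<^sub>k\<close> is square summable. Comparing with \<open>(x*, c x*)\<close> then bounds the limsup.\<close>

section \<open>Lower semicontinuity, Moreau envelope and proximal point\<close>

text \<open>\<open>lsc\<close> speaks of the punctured filter \<open>at l\<close>; the strict bound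
  \<open>a < g l\<close> fills in the point itself, so that \<open>u\<close> may take the value
  \<open>l\<close>.\<close>

lemma lsc_le_liminf:
  fixes g :: "'a::first_countable_topology \<Rightarrow> ereal"
  assumes "lsc g" and lim: "(u \<longlongrightarrow> l) F"
  shows "g l \<le> Liminf F (\<lambda>k. g (u k))"
  unfolding le_Liminf_iff
proof (intro allI impI)
  fix a assume a: "a < g l"
  have "g l \<le> Liminf (at l) g"
    using assms(1) by (simp add: lsc_def)
  with a have "eventually (\<lambda>w. a < g w) (at l)"
    unfolding le_Liminf_iff by blast
  with a have "eventually (\<lambda>w. a < g w) (nhds l)"
    unfolding eventually_at_filter by (auto elim: eventually_mono)
  with lim show "eventually (\<lambda>k. a < g (u k)) F"
    unfolding filterlim_iff by blast
qed

lemma lsc_le_limit: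
  fixes g :: "'a::first_countable_topology \<Rightarrow> ereal"
  assumes "lsc g" "u \<longlonglongrightarrow> l" "\<And>k. g (u k) \<le> ereal (b k)" "b \<longlonglongrightarrow> B"
  shows "g l \<le> ereal B"
proof -
  have "g l \<le> liminf (\<lambda>k. g (u k))"
    by (rule lsc_le_liminf[OF assms(1,2)])
  also have "\<dots> \<le> liminf (\<lambda>k. ereal (b k))"
    using assms(3) by (intro Liminf_mono) auto
  also have "\<dots> = ereal B"
    using assms(4) by (intro lim_imp_Liminf) auto
  finally show ?thesis .
qed

lemma proper_obtain_real:
  assumes "proper g" "g z < \<infinity>"
  obtains a where "g z = ereal a"
  using assms unfolding proper_def by (cases "g z") auto

lemma midpoint_norm_sq:
  fixes u v s :: "'a::real_inner"
  shows "(norm ((1/2) *\<^sub>R u + (1/2) *\<^sub>R v - s))\<^sup>2 =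
    (norm (u - s))\<^sup>2 / 2 + (norm (v - s))\<^sup>2 / 2 - (norm (u - v))\<^sup>2 / 4"
  by (simp add: power2_norm_eq_inner inner_diff_left inner_diff_right inner_add_left
      inner_add_right inner_commute field_simps)

text \<open>The affine minorant keeps the infimum finite. Strong convexity makes minimizing
  sequences Cauchy, so completeness provides a limit, and lower semicontinuity shows that it is a
  minimizer.\<close>

lemma moreau_argmin_ex1:
  fixes g :: "'a::{real_inner,complete_space} \<Rightarrow> ereal"
  assumes g: "proper g" "lsc g" "econvex g"
    and minorant: "\<And>w. ereal (a + p \<bullet> w) \<le> g w"
    and mu: "\<mu> > 0"
  shows "\<exists>!w. is_arg_min (\<lambda>w. g w + ereal (1 / (2 * \<mu>) * (norm (w - s))\<^sup>2)) (\<lambda>_. True) w"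
proof -
  define q where "q w = 1 / (2 * \<mu>) * (norm (w - s))\<^sup>2" for w
  define h where "h w = g w + ereal (q w)" for w
  \<comment> \<open>Near-minimizers are close to each other: the parallelogram law at the midpoint
    gives the factor 1/4, which the weight \<open>1 / (2 * \<mu>)\<close> in \<open>q\<close> turns
    into \<open>1 / (8 * \<mu>)\<close>.\<close>
  have mid: "(norm (u - v))\<^sup>2 / (8 * \<mu>) \<le> (A + B) / 2 - m"
    if uv: "h u \<le> ereal A" "h v \<le> ereal B" and m: "\<And>w. ereal m \<le> h w" for u v A B m
  proof -
    let ?w = "(1/2) *\<^sub>R u + (1/2) *\<^sub>R v"
    have "g u < \<infinity>" "g v < \<infinity>"
      using uv by (auto simp: h_def)
    then obtain U V where UV: "g u = ereal U" "g v = ereal V"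
      using proper_obtain_real[OF g(1)] by metis
    have "g ?w \<le> ereal ((U + V) / 2)"
      using g(3)[unfolded econvex_def, rule_format, of "1/2" u v] UV by (simp add: field_simps)
    moreover have "ereal m \<le> g ?w + ereal (q ?w)"
      using m[of ?w] by (simp add: h_def)
    ultimately have "m \<le> (U + V) / 2 + q ?w"
      by (cases "g ?w") (auto simp: field_simps)
    moreover have "q ?w = q u / 2 + q v / 2 - (norm (u - v))\<^sup>2 / (8 * \<mu>)"
      unfolding q_def midpoint_norm_sq using mu by (simp add: field_simps)
    moreover have "U + q u \<le> A" "V + q v \<le> B"
      using uv UV by (auto simp: h_def)
    ultimately show ?thesis by argo
  qed
  \<comment> \<open>The minimum over \<open>w\<close> of \<open>a + p \<bullet> w + q w\<close>,
    attained at \<open>s - \<mu> *\<^sub>R p\<close>.\<close>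
  define b where "b = a + p \<bullet> s - \<mu> * (norm p)\<^sup>2 / 2"
  have below: "ereal b \<le> h w" for w
  proof -
    have "0 \<le> (norm ((w - s) + \<mu> *\<^sub>R p))\<^sup>2 / (2 * \<mu>)"
      using mu by simp
    also have "(norm ((w - s) + \<mu> *\<^sub>R p))\<^sup>2 =
        (norm (w - s))\<^sup>2 + 2 * \<mu> * (p \<bullet> (w - s)) + \<mu>\<^sup>2 * (norm p)\<^sup>2"
      unfolding power2_norm_eq_inner inner_add_left inner_add_right
      by (simp add: inner_commute power2_eq_square)
    also have "\<dots> / (2 * \<mu>) = q w + p \<bullet> (w - s) + \<mu> * (norm p)\<^sup>2 / 2"
      using mu by (simp add: q_def field_simps power2_eq_square)
    finally have "ereal b \<le> ereal (a + p \<bullet> w) + ereal (q w)"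
      by (simp add: b_def inner_diff_right)
    also have "\<dots> \<le> h w"
      unfolding h_def by (intro add_right_mono minorant)
    finally show ?thesis .
  qed
  obtain w0 where "g w0 < \<infinity>"
    using g(1) by (auto simp: proper_def edom_def)
  then obtain A0 where A0: "h w0 = ereal A0"
    using proper_obtain_real[OF g(1)] by (metis h_def plus_ereal.simps(1))
  have "ereal b \<le> (INF w. h w)"
    by (intro INF_greatest below)
  moreover have "(INF w. h w) \<le> ereal A0"
    using INF_lower[of w0 UNIV h] A0 by simp
  ultimately obtain m where m: "(INF w. h w) = ereal m"
    by (cases "INF w. h w") auto
  have m_le: "ereal m \<le> h w" for w
    unfolding m[symmetric] by (rule INF_lower) simp
  have "\<exists>w. h w \<le> ereal (m + 1 / (real n + 1))" for n :: nat
  proof (rule ccontr)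
    assume "\<nexists>w. h w \<le> ereal (m + 1 / (real n + 1))"
    then have "ereal (m + 1 / (real n + 1)) \<le> (INF w. h w)"
      by (intro INF_greatest) (metis linorder_linear)
    then show False by (simp add: m divide_le_0_iff)
  qed
  then obtain W where W: "\<And>n. h (W n) \<le> ereal (m + 1 / (real n + 1))"
    by metis
  txt \<open>Strong convexity makes any minimizing sequence Cauchy.\<close>
  have "Cauchy W"
  proof (rule metric_CauchyI)
    fix e :: real assume e: "e > 0"
    obtain N :: nat where N: "8 * \<mu> / e\<^sup>2 < real N"
      using reals_Archimedean2 by blast
    have "dist (W i) (W j) < e" if ij: "i \<ge> N" "j \<ge> N" for i j
    proof -
      have N1: "1 / (real k + 1) < e\<^sup>2 / (8 * \<mu>)" if "k \<ge> N" for k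
      proof -
        have "8 * \<mu> / e\<^sup>2 < real k + 1" using N that by linarith
        then show ?thesis using e mu by (simp add: field_simps)
      qed
      have "(norm (W i - W j))\<^sup>2 / (8 * \<mu>) \<le>
          ((m + 1 / (real i + 1)) + (m + 1 / (real j + 1))) / 2 - m"
        by (rule mid[OF W W m_le])
      also have "\<dots> < e\<^sup>2 / (8 * \<mu>)"
        using N1[OF ij(1)] N1[OF ij(2)] by argo
      finally have "(norm (W i - W j))\<^sup>2 < e\<^sup>2"
        using mu by (simp add: divide_less_cancel)
      then show ?thesis
        using e by (simp add: dist_norm power2_less_imp_less)
    qed
    then show "\<exists>M. \<forall>i\<ge>M. \<forall>j\<ge>M. dist (W i) (W j) < e" by blast
  qed
  then obtain l where l: "W \<longlonglongrightarrow> l"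
    using Cauchy_convergent convergent_def by blast
  \<comment> \<open>Moving the continuous term \<open>q\<close> to the right leaves a bound on
    \<open>g\<close> alone, to which lower semicontinuity applies.\<close>
  have "g l \<le> ereal (m - q l)"
  proof (rule lsc_le_limit[OF g(2) l])
    show "g (W n) \<le> ereal (m + inverse (real (Suc n)) - q (W n))" for n
      using W[of n] unfolding h_def
      by (cases "g (W n)") (auto simp: inverse_eq_divide add.commute)
    have "(\<lambda>n. q (W n)) \<longlonglongrightarrow> q l"
      unfolding q_def by (intro tendsto_intros l)
    then show "(\<lambda>n. m + inverse (real (Suc n)) - q (W n)) \<longlonglongrightarrow> m - q l"
      using tendsto_add[OF tendsto_const[of m] LIMSEQ_inverse_real_of_nat]
      by (intro tendsto_diff) auto
  qed
  then have hl: "h l \<le> ereal m"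
    unfolding h_def by (cases "g l") auto
  have "is_arg_min h (\<lambda>_. True) l"
    using hl m_le by (auto simp: is_arg_min_linorder intro: order_trans)
  \<comment> \<open>Uniqueness is \<open>mid\<close> with both values equal to the infimum
    \<open>m\<close>.\<close>
  moreover have "w = l" if "is_arg_min h (\<lambda>_. True) w" for w
  proof -
    have "h w \<le> ereal m"
      using that hl by (auto simp: is_arg_min_linorder intro: order_trans)
    from mid[OF this hl m_le] have "(norm (w - l))\<^sup>2 / (8 * \<mu>) \<le> 0" by simp
    then have "(norm (w - l))\<^sup>2 \<le> 0"
      using mu by (simp add: divide_le_0_iff)
    then show ?thesis by simp
  qed
  ultimately show ?thesis
    unfolding h_def q_def by blast
qed

text \<open>Up to the positive factor \<open>\<mu>\<close>, the objective in \<open>prox\<close> is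
  the one in the Moreau envelope, so the proximal point attains the envelope.\<close>

lemma moreau_eq_prox:
  fixes g :: "'a::{real_inner,complete_space} \<Rightarrow> ereal" and s :: 'a
  assumes g: "proper g" "lsc g" "econvex g"
    and minorant: "\<And>w. ereal (a + p \<bullet> w) \<le> g w"
    and mu: "\<mu> > 0"
  defines "z \<equiv> prox (\<lambda>w. ereal \<mu> * g w) s"
  shows "moreau \<mu> g s = g z + ereal (1 / (2 * \<mu>) * (norm (z - s))\<^sup>2)" "g z < \<infinity>"
proof -
  define h where "h w = g w + ereal (1 / (2 * \<mu>) * (norm (w - s))\<^sup>2)" for w
  have "ereal \<mu> * g w + ereal (1 / 2 * (norm (w - s))\<^sup>2) = ereal \<mu> * h w" for w
    using mu g(1) unfolding h_def proper_def by (cases "g w") (auto simp: field_simps)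
  moreover have "is_arg_min (\<lambda>w. ereal \<mu> * h w) (\<lambda>_. True) = is_arg_min h (\<lambda>_. True)"
    using mu by (auto simp: fun_eq_iff is_arg_min_linorder ereal_mult_le_mult_iff)
  ultimately have "z = (THE w. is_arg_min h (\<lambda>_. True) w)"
    unfolding z_def prox_def by simp
  then have z: "is_arg_min h (\<lambda>_. True) z"
    using theI'[OF moreau_argmin_ex1[OF g minorant mu, of s]] by (simp add: h_def[abs_def])
  then have "(INF w. h w) = h z"
    by (intro antisym INF_lower INF_greatest) (auto simp: is_arg_min_linorder)
  then show "moreau \<mu> g s = g z + ereal (1 / (2 * \<mu>) * (norm (z - s))\<^sup>2)"
    by (simp add: moreau_def h_def)
  obtain w0 where "g w0 < \<infinity>"
    using g(1) by (auto simp: proper_def edom_def)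
  then have "h w0 < \<infinity>"
    by (simp add: h_def)
  moreover have "h z \<le> h w0"
    using z by (simp add: is_arg_min_linorder)
  ultimately show "g z < \<infinity>"
    by (auto simp: h_def)
qed

section \<open>Minimal value, multipliers and convexity of the composite problem\<close>

text \<open>Infeasible points have objective \<open>\<infinity>\<close>, so the infimum over all
  \<open>x\<close> is the minimum over the feasible ones.\<close>

lemma minimizer_value:
  assumes P: "composite_problem f g c" and xs: "is_minimizer f g c xs"
  obtains G where "g (c xs) = ereal G" "min_value f g c = ereal (f xs + G)"
proof -
  have pr: "proper g" using P by (simp add: composite_problem_def)
  have "g (c xs) < \<infinity>"
    using xs by (simp add: is_minimizer_def is_arg_min_def feasible_def edom_def)
  then obtain G where G: "g (c xs) = ereal G"
    using proper_obtain_real[OF pr] by metis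
  have "objective f g c xs \<le> objective f g c x" for x
  proof (cases "feasible g c x")
    case True
    then show ?thesis
      using xs by (simp add: is_minimizer_def is_arg_min_linorder)
  next
    case False
    then show ?thesis by (simp add: feasible_def edom_def objective_def)
  qed
  then have "min_value f g c = objective f g c xs"
    unfolding min_value_def by (intro antisym INF_lower INF_greatest) auto
  with that[OF G] G show ?thesis by (simp add: objective_def)
qed

lemma is_minimizer_if_le_min_value:
  assumes "composite_problem f g c" "objective f g c x \<le> min_value f g c"
  shows "is_minimizer f g c x"
proof -
  obtain xs where "is_minimizer f g c xs"
    using assms(1) by (auto simp: composite_problem_def)
  then obtain G where "min_value f g c = ereal (f xs + G)"
    using minimizer_value[OF assms(1)] by blast
  then have "feasible g c x"
    using assms(2) by (auto simp: objective_def feasible_def edom_def)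
  moreover have "objective f g c x \<le> objective f g c x'" for x'
    using assms(2) unfolding min_value_def by (meson INF_lower UNIV_I order_trans)
  ultimately show ?thesis
    by (simp add: is_minimizer_def is_arg_min_linorder)
qed

text \<open>Adds the minimality of \<open>xs\<close> for \<open>f + p \<bullet> c\<close> to the
  subgradient inequality at \<open>c xs\<close>. In terms of \<open>u = c x - w\<close>,
  \<open>- p\<close> is a subgradient at 0 of the optimal value as a function of the perturbation
  \<open>u\<close>.\<close>

lemma multiplier_lower_bound:
  fixes f :: "real^'n \<Rightarrow> real" and c :: "real^'n \<Rightarrow> real^'m"
  assumes P: "composite_problem f g c" and p: "p \<in> multipliers f g c xs"
    and G: "g (c xs) = ereal G" "g w = ereal H"
  shows "f xs + G \<le> f x + H + p \<bullet> (c x - w)"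
proof -
  have "f xs + p \<bullet> c xs \<le> f x + p \<bullet> c x" "g (c xs) + ereal (p \<bullet> (w - c xs)) \<le> g w"
    using p multipliers_iff[OF P] by (auto simp: subdifferential_def)
  with G show ?thesis by (simp add: inner_diff_right)
qed

text \<open>The defect \<open>v\<close> of \<open>c\<close> on the segment lies in
  \<open>hzn g\<close>. Adding it to the convex combination of \<open>w\<close> and
  \<open>w'\<close> does not raise \<open>g\<close>, and it makes the residual
  \<open>c x - w\<close> exactly affine along the segment.\<close>

lemma composite_convex:
  fixes f :: "real^'n \<Rightarrow> real" and c :: "real^'n \<Rightarrow> real^'m"
  assumes P: "composite_problem f g c"
    and G: "g w = ereal G" "g w' = ereal G'" and t: "0 \<le> t" "t \<le> 1"
  obtains x'' w'' where "c x'' - w'' = t *\<^sub>R (c x - w) + (1 - t) *\<^sub>R (c x' - w')"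
    "ereal (f x'') + g w'' \<le> ereal (t * (f x + G) + (1 - t) * (f x' + G'))"
proof -
  define x'' where "x'' = t *\<^sub>R x + (1 - t) *\<^sub>R x'"
  define v where "v = c x'' - t *\<^sub>R c x - (1 - t) *\<^sub>R c x'"
  define w1 where "w1 = t *\<^sub>R w + (1 - t) *\<^sub>R w'"
  have v: "v \<in> hzn g"
    using P t by (auto simp: v_def x''_def composite_problem_def)
  have "econvex g" using P by (simp add: composite_problem_def)
  then have g1: "g w1 \<le> ereal (t * G + (1 - t) * G')"
    using t G unfolding econvex_def w1_def by (metis atLeastAtMost_iff plus_ereal.simps(1) times_ereal.simps(1))
  then have "w1 \<in> edom g"
    by (auto simp: edom_def)
  with v have "g (w1 + v) \<le> g w1"
    by (simp add: hzn_def)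
  with g1 have g2: "g (w1 + v) \<le> ereal (t * G + (1 - t) * G')"
    by (rule order_trans[rotated])
  have fx: "f x'' \<le> t * f x + (1 - t) * f x'"
    using P t convex_onD[of UNIV f "1 - t" x x'] by (simp add: composite_problem_def x''_def)
  show ?thesis
  proof
    show "c x'' - (w1 + v) = t *\<^sub>R (c x - w) + (1 - t) *\<^sub>R (c x' - w')"
      by (simp add: v_def w1_def algebra_simps)
    have "ereal (f x'') + g (w1 + v) \<le> ereal (t * f x + (1 - t) * f x') + ereal (t * G + (1 - t) * G')"
      by (intro add_mono g2) (simp add: fx)
    then show "ereal (f x'') + g (w1 + v) \<le> ereal (t * (f x + G) + (1 - t) * (f x' + G'))"
      by (simp add: algebra_simps)
  qed
qed

section \<open>Estimates for one augmented Lagrangian step\<close>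

text \<open>The square in the Moreau envelope, less the term subtracted in
  \<open>aug_lagrangian\<close>, is a multiplier term plus a penalty.\<close>

lemma shifted_norm_sq:
  fixes u y :: "'a::real_inner"
  assumes "\<mu> > 0"
  shows "1 / (2 * \<mu>) * (norm (u + \<mu> *\<^sub>R y))\<^sup>2 - \<mu> / 2 * (norm y)\<^sup>2 = u \<bullet> y + (norm u)\<^sup>2 / (2 * \<mu>)"
  using assms unfolding power2_norm_eq_inner
  by (simp add: inner_add_left inner_add_right inner_commute field_simps power2_eq_square)

text \<open>Each \<open>w\<close> competes in the infimum that defines the Moreau envelope.\<close>

lemma aug_lagrangian_le:
  fixes c :: "'a \<Rightarrow> 'b::real_inner"
  assumes mu: "\<mu> > 0" and F: "ereal (f x) + g w \<le> ereal F"
  shows "aug_lagrangian f g c \<mu> x y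
    \<le> ereal (F + (c x - w) \<bullet> y + (norm (c x - w))\<^sup>2 / (2 * \<mu>))"
proof -
  have "moreau \<mu> g (c x + \<mu> *\<^sub>R y) \<le> g w + ereal (1 / (2 * \<mu>) * (norm (w - (c x + \<mu> *\<^sub>R y)))\<^sup>2)"
    unfolding moreau_def by (rule INF_lower) simp
  moreover have "norm (w - (c x + \<mu> *\<^sub>R y)) = norm ((c x - w) + \<mu> *\<^sub>R y)"
    by (metis add_diff_eq add.commute diff_add_eq norm_minus_commute)
  ultimately have "moreau \<mu> g (c x + \<mu> *\<^sub>R y) \<le> g w + ereal (1 / (2 * \<mu>) * (norm ((c x - w) + \<mu> *\<^sub>R y))\<^sup>2)"
    by metis
  then have "aug_lagrangian f g c \<mu> x y \<le> ereal (f x) +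
     (g w + ereal (1 / (2 * \<mu>) * (norm ((c x - w) + \<mu> *\<^sub>R y))\<^sup>2)) - ereal (\<mu> / 2 * (norm y)\<^sup>2)"
    unfolding aug_lagrangian_def by (intro ereal_minus_mono add_left_mono) auto
  also have "\<dots> = (ereal (f x) + g w) + ereal ((c x - w) \<bullet> y + (norm (c x - w))\<^sup>2 / (2 * \<mu>))"
    unfolding shifted_norm_sq[OF mu, symmetric] by (cases "g w") auto
  also have "\<dots> \<le> ereal F + ereal ((c x - w) \<bullet> y + (norm (c x - w))\<^sup>2 / (2 * \<mu>))"
    by (intro add_right_mono F)
  finally show ?thesis by (simp add: add.assoc)
qed

text \<open>The first estimate serves to bound the objective values, the second to drive the
  residual to zero.\<close>

lemma ALM_step:
  fixes f :: "real^'n \<Rightarrow> real" and c :: "real^'n \<Rightarrow> real^'m"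
  assumes P: "composite_problem f g c" and xs: "is_minimizer f g c xs"
    and p: "p \<in> multipliers f g c xs" and mu: "\<mu> > 0"
    and min: "aug_lagrangian f g c \<mu> x y \<le> (INF x'. aug_lagrangian f g c \<mu> x' y) + ereal e"
    and z: "z = prox (\<lambda>w. ereal \<mu> * g w) (c x + \<mu> *\<^sub>R y)"
    and opt: "min_value f g c = ereal \<phi>"
  obtains G where "g z = ereal G"
    "f x + G + (c x - z) \<bullet> y + (norm (c x - z))\<^sup>2 / (2 * \<mu>) \<le> \<phi> + e"
    "(c x - z) \<bullet> (y - p) + 3 / 4 * (norm (c x - z))\<^sup>2 / \<mu> \<le> 2 * e"
proof -
  define r where "r = c x - z"
  obtain Gs where Gs: "g (c xs) = ereal Gs" and "min_value f g c = ereal (f xs + Gs)"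
    using minimizer_value[OF P xs] .
  with opt have \<phi>: "\<phi> = f xs + Gs" by simp
  have g: "proper g" "lsc g" "econvex g"
    using P by (auto simp: composite_problem_def)
  \<comment> \<open>The subgradient inequality of the multiplier supplies the affine minorant that
    the proximal point requires.\<close>
  have minorant: "ereal ((Gs - p \<bullet> c xs) + p \<bullet> w) \<le> g w" for w
    using p Gs unfolding multipliers_def subdifferential_def
    by (auto simp: inner_diff_right dest!: spec[of _ w])
      (metis add.commute add_diff_eq diff_add_eq)
  note pr = moreau_eq_prox[OF g minorant mu, of "c x + \<mu> *\<^sub>R y", folded z]
  obtain G where G: "g z = ereal G"
    using proper_obtain_real[OF g(1) pr(2)] .
  have "norm (z - (c x + \<mu> *\<^sub>R y)) = norm (r + \<mu> *\<^sub>R y)"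
    unfolding r_def by (metis add_diff_eq add.commute diff_add_eq norm_minus_commute)
  then have "aug_lagrangian f g c \<mu> x y =
      ereal (f x + G + (1 / (2 * \<mu>) * (norm (r + \<mu> *\<^sub>R y))\<^sup>2 - \<mu> / 2 * (norm y)\<^sup>2))"
    unfolding aug_lagrangian_def pr(1) G by simp
  then have Lx: "aug_lagrangian f g c \<mu> x y = ereal (f x + G + r \<bullet> y + (norm r)\<^sup>2 / (2 * \<mu>))"
    unfolding shifted_norm_sq[OF mu] by simp
  \<comment> \<open>The competitor moves from \<open>(xs, c xs)\<close> at \<open>t = 0\<close> to
    \<open>(x, z)\<close> at \<open>t = 1\<close>. As \<open>(xs, c xs)\<close> has residual zero,
    the multiplier term scales by \<open>t\<close> and the penalty by
    \<open>t\<^sup>2\<close>.\<close>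
  have key: "f x + G + r \<bullet> y + (norm r)\<^sup>2 / (2 * \<mu>)
     \<le> t * (f x + G) + (1 - t) * \<phi> + t * (r \<bullet> y) + t\<^sup>2 * (norm r)\<^sup>2 / (2 * \<mu>) + e"
    if t: "0 \<le> t" "t \<le> 1" for t
  proof -
    obtain x' w' where u: "c x' - w' = t *\<^sub>R (c x - z) + (1 - t) *\<^sub>R (c xs - c xs)"
      and F: "ereal (f x') + g w' \<le> ereal (t * (f x + G) + (1 - t) * (f xs + Gs))"
      using composite_convex[OF P G Gs t] .
    have u': "c x' - w' = t *\<^sub>R r" using u by (simp add: r_def)
    have "(INF x'. aug_lagrangian f g c \<mu> x' y) \<le> aug_lagrangian f g c \<mu> x' y"
      by (rule INF_lower) simp
    also have "\<dots> \<le> ereal (t * (f x + G) + (1 - t) * (f xs + Gs) + (c x' - w') \<bullet> y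
        + (norm (c x' - w'))\<^sup>2 / (2 * \<mu>))"
      by (rule aug_lagrangian_le[where f = f and g = g and c = c, OF mu F])
    finally have "(INF x'. aug_lagrangian f g c \<mu> x' y) \<le>
      ereal (t * (f x + G) + (1 - t) * \<phi> + t * (r \<bullet> y) + t\<^sup>2 * (norm r)\<^sup>2 / (2 * \<mu>))"
      by (simp add: u' \<phi> power_mult_distrib)
    from order_trans[OF min add_right_mono[OF this, of "ereal e"]] show ?thesis
      unfolding Lx by simp
  qed
  have "\<phi> \<le> f x + G + p \<bullet> r"
    unfolding \<phi> r_def by (rule multiplier_lower_bound[OF P p Gs G])
  \<comment> \<open>At \<open>t = 1/2\<close> the penalty falls from 1/2 to 1/8 of
    \<open>(norm r)\<^sup>2 / \<mu>\<close>. Doubling this gain of 3/8 yields the 3/4 and the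
    \<open>2 * e\<close>.\<close>
  moreover have "f x + G + r \<bullet> y + (norm r)\<^sup>2 / (2 * \<mu>)
     \<le> 1/2 * (f x + G) + (1 - 1/2) * \<phi> + 1/2 * (r \<bullet> y) + (1/2)\<^sup>2 * (norm r)\<^sup>2 / (2 * \<mu>) + e"
    by (rule key) auto
  moreover have "(1/2)\<^sup>2 * (norm r)\<^sup>2 / (2 * \<mu>) = (norm r)\<^sup>2 / \<mu> / 8"
    "(norm r)\<^sup>2 / (2 * \<mu>) = (norm r)\<^sup>2 / \<mu> / 2"
    "3 / 4 * (norm r)\<^sup>2 / \<mu> = 3 / 4 * ((norm r)\<^sup>2 / \<mu>)"
    by (simp_all add: power2_eq_square)
  moreover have "r \<bullet> (y - p) = r \<bullet> y - p \<bullet> r"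
    by (simp add: inner_diff_right inner_commute)
  ultimately have "r \<bullet> (y - p) + 3 / 4 * (norm r)\<^sup>2 / \<mu> \<le> 2 * e"
    by argo
  \<comment> \<open>At \<open>t = 0\<close> the competitor is \<open>(xs, c xs)\<close>
    itself.\<close>
  moreover have "f x + G + r \<bullet> y + (norm r)\<^sup>2 / (2 * \<mu>) \<le> \<phi> + e"
    using key[of 0] by simp
  ultimately show ?thesis
    using that[OF G] unfolding r_def by blast
qed

section \<open>Summability\<close>

text \<open>Eventually \<open>sqrt (a k) < 1\<close>, and from there on
  \<open>a k \<le> sqrt (a k)\<close>.\<close>

lemma summable_of_summable_sqrt:
  assumes "summable (\<lambda>k. sqrt (a k))" and nonneg: "\<And>k::nat. 0 \<le> a k"
  shows "summable a"
proof (rule summable_comparison_test_ev[OF _ assms(1)])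
  have "(\<lambda>k. sqrt (a k)) \<longlonglongrightarrow> 0"
    by (rule summable_LIMSEQ_zero[OF assms(1)])
  then have "eventually (\<lambda>k. sqrt (a k) < 1) sequentially"
    by (rule order_tendstoD) simp
  then show "eventually (\<lambda>k. norm (a k) \<le> sqrt (a k)) sequentially"
  proof eventually_elim
    case (elim k)
    have "sqrt (a k) * sqrt (a k) \<le> sqrt (a k) * 1"
      using elim nonneg[of k] by (intro mult_left_mono) auto
    then show ?case using nonneg[of k] by simp
  qed
qed

text \<open>Telescoping bounds the partial sums of \<open>d\<close> by \<open>a 0\<close> plus the
  sum of \<open>b\<close>.\<close>

lemma summable_of_descent:
  fixes a b d :: "nat \<Rightarrow> real"
  assumes step: "\<And>k. a (Suc k) + d k \<le> a k + b k"
    and nonneg: "\<And>k. 0 \<le> a k" "\<And>k. 0 \<le> b k" "\<And>k. 0 \<le> d k" and "summable b"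
  shows "summable d"
proof (rule bounded_imp_summable)
  have *: "a n + (\<Sum>k<n. d k) \<le> a 0 + (\<Sum>k<n. b k)" for n
  proof (induction n)
    case (Suc n)
    then show ?case using step[of n] by simp
  qed simp
  show "(\<Sum>k\<le>n. d k) \<le> a 0 + suminf b" for n
    using *[of "Suc n"] nonneg(1)[of "Suc n"] sum_le_suminf[OF \<open>summable b\<close>, of "{..<Suc n}"] nonneg(2)
    by (simp add: lessThan_Suc_atMost)
qed (rule nonneg)

section \<open>Convergence of residuals and objective values\<close>

theorem corollary5p5:
  fixes f :: "real^'n \<Rightarrow> real"
    and g :: "real^'m \<Rightarrow> ereal"
    and c :: "real^'n \<Rightarrow> real^'m"
    and y0 :: "real^'m" and \<mu>0 \<beta> :: real and S :: "(real^'m) set"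
    and x :: "nat \<Rightarrow> real^'n" and z y yhat :: "nat \<Rightarrow> real^'m"
    and \<epsilon> \<mu> :: "nat \<Rightarrow> real"
  assumes "composite_problem f g c"
    and "\<exists>xs. is_minimizer f g c xs \<and> stationary f g c xs"
    and "safeguarded_ALM f g c y0 \<mu>0 S \<beta> x z y yhat \<epsilon> \<mu>"
    and "summable (\<lambda>k. sqrt (\<epsilon> k / \<mu> k))"
    and "\<mu> \<longlonglongrightarrow> 0 \<or> multiplier_set f g c \<inter> S \<noteq> {}"
  shows "(\<lambda>k. c (x k) - z k) \<longlonglongrightarrow> 0
    \<and> limsup (\<lambda>k. ereal (f (x k)) + g (z k)) \<le> min_value f g c
    \<and> (\<forall>xbar. (\<exists>r. strict_mono r \<and> (x \<circ> r) \<longlonglongrightarrow> xbar) \<longrightarrow> is_minimizer f g c xbar)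
    \<and> (\<forall>r xbar. strict_mono r \<and> (x \<circ> r) \<longlonglongrightarrow> xbar \<longrightarrow>
          (z \<circ> r) \<longlonglongrightarrow> c xbar
          \<and> (\<lambda>k. ereal (f (x (r k))) + g (z (r k))) \<longlonglongrightarrow> min_value f g c)"
proof -
  note P = assms(1) and ALM = assms(3)[unfolded safeguarded_ALM_def]
  have S: "S \<noteq> {}" "convex S" "closed S" "bounded S"
    using ALM by (auto simp: compact_imp_closed compact_imp_bounded)
  obtain xs where xs: "is_minimizer f g c xs" and st: "stationary f g c xs"
    using assms(2) by blast
  obtain \<phi> where \<phi>: "min_value f g c = ereal \<phi>"
    using minimizer_value[OF P xs] by metis
  define r where "r k = c (x k) - z k" for k
  have mu_pos: "\<mu> k > 0" for k
  proof (induction k)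
    case (Suc k)
    obtain b where "b \<in> {0<..\<beta>} \<union> {1}" "\<mu> (Suc k) = b * \<mu> k" using ALM by blast
    with Suc show ?case by auto
  qed (use ALM in auto)
  have mu_le: "\<mu> k \<le> \<mu>0" for k
  proof (induction k)
    case (Suc k)
    obtain b where b: "b \<in> {0<..\<beta>} \<union> {1}" "\<mu> (Suc k) = b * \<mu> k" using ALM by blast
    then have "b * \<mu> k \<le> 1 * \<mu> k"
      using ALM mu_pos[of k] by (intro mult_right_mono) auto
    with b Suc show ?case by simp
  qed (use ALM in auto)
  have eps: "0 \<le> \<epsilon> k" for k using ALM by blast
  have sum_em: "summable (\<lambda>k. \<epsilon> k / \<mu> k)"
    by (rule summable_of_summable_sqrt[OF assms(4) divide_nonneg_pos[OF eps mu_pos]])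
  have em: "(\<lambda>k. \<epsilon> k / \<mu> k) \<longlonglongrightarrow> 0"
    by (rule summable_LIMSEQ_zero[OF sum_em])
  have eps_lim: "\<epsilon> \<longlonglongrightarrow> 0"
  proof (rule Lim_null_comparison)
    show "(\<lambda>k. \<mu>0 * (\<epsilon> k / \<mu> k)) \<longlonglongrightarrow> 0"
      by (rule tendsto_mult_right_zero[OF em])
    have "norm (\<epsilon> k) \<le> \<mu>0 * (\<epsilon> k / \<mu> k)" for k
      using mult_right_mono[OF mu_le[of k], of "\<epsilon> k / \<mu> k"] eps[of k] mu_pos[of k] by simp
    then show "eventually (\<lambda>k. norm (\<epsilon> k) \<le> \<mu>0 * (\<epsilon> k / \<mu> k)) sequentially" by simp
  qed
  have yS: "yhat k \<in> S" for k
    using ALM S by (metis closest_point_in_set)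
  obtain B where B: "\<And>v. v \<in> S \<Longrightarrow> norm v \<le> B"
    using S(4) bounded_iff by blast
  \<comment> \<open>Kept general in \<open>p\<close>: for
    \<open>\<mu> \<longlonglongrightarrow> 0\<close> any multiplier will do, while the other case
    takes one from \<open>S\<close>.\<close>
  have step: "\<exists>G. g (z k) = ereal G \<and>
      f (x k) + G + r k \<bullet> yhat k + (norm (r k))\<^sup>2 / (2 * \<mu> k) \<le> \<phi> + \<epsilon> k \<and>
      r k \<bullet> (yhat k - p) + 3 / 4 * (norm (r k))\<^sup>2 / \<mu> k \<le> 2 * \<epsilon> k"
    if p: "p \<in> multipliers f g c xs" for p k
  proof -
    have "aug_lagrangian f g c (\<mu> k) (x k) (yhat k)
            \<le> (INF x'. aug_lagrangian f g c (\<mu> k) x' (yhat k)) + ereal (\<epsilon> k)"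
      "z k = prox (\<lambda>w. ereal (\<mu> k) * g w) (c (x k) + \<mu> k *\<^sub>R yhat k)"
      using ALM by blast+
    from ALM_step[OF P xs p mu_pos this \<phi>] obtain G where "g (z k) = ereal G"
      "f (x k) + G + (c (x k) - z k) \<bullet> yhat k + (norm (c (x k) - z k))\<^sup>2 / (2 * \<mu> k) \<le> \<phi> + \<epsilon> k"
      "(c (x k) - z k) \<bullet> (yhat k - p) + 3 / 4 * (norm (c (x k) - z k))\<^sup>2 / \<mu> k \<le> 2 * \<epsilon> k" .
    then show ?thesis unfolding r_def by blast
  qed
  obtain p0 where p0: "p0 \<in> multipliers f g c xs"
    using st by (auto simp: stationary_def)
  have r_lim: "r \<longlonglongrightarrow> 0"
    using assms(5)
  proof
    assume mu0: "\<mu> \<longlonglongrightarrow> 0"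
    define C where "C = B + norm p0"
    \<comment> \<open>Cauchy-Schwarz and \<open>yhat k \<in> S\<close> bound the inner product.
      Young's inequality, in the form of the square with shift \<open>4 / 3 * (C * \<mu> k)\<close>,
      then absorbs half of the coefficient 3/4.\<close>
    have bound: "(norm (r k))\<^sup>2 \<le> 16 / 3 * (\<mu> k * \<epsilon> k) + 16 / 9 * (C * \<mu> k)\<^sup>2" for k
    proof -
      have "r k \<bullet> (yhat k - p0) + 3 / 4 * (norm (r k))\<^sup>2 / \<mu> k \<le> 2 * \<epsilon> k"
        using step[OF p0, of k] by blast
      moreover have "- (r k \<bullet> (yhat k - p0)) \<le> norm (r k) * C"
      proof -
        have "- (r k \<bullet> (yhat k - p0)) \<le> norm (r k) * norm (yhat k - p0)"
          using Cauchy_Schwarz_ineq2[of "r k" "yhat k - p0"] by linarith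
        also have "\<dots> \<le> norm (r k) * C"
          using B[OF yS[of k]] norm_triangle_ineq4[of "yhat k" p0]
          by (intro mult_left_mono) (auto simp: C_def)
        finally show ?thesis .
      qed
      ultimately have "3 / 4 * (norm (r k))\<^sup>2 / \<mu> k \<le> 2 * \<epsilon> k + norm (r k) * C"
        by linarith
      then have "3 / 4 * (norm (r k))\<^sup>2 \<le> 2 * (\<mu> k * \<epsilon> k) + norm (r k) * (C * \<mu> k)"
        using mu_pos[of k] by (simp add: pos_divide_le_eq algebra_simps)
      moreover have "0 \<le> (norm (r k) - 4 / 3 * (C * \<mu> k))\<^sup>2"
        by simp
      ultimately show ?thesis
        by (simp add: power2_diff power2_eq_square algebra_simps)
    qed
    have "(\<lambda>k. 16 / 3 * (\<mu> k * \<epsilon> k) + 16 / 9 * (C * \<mu> k)\<^sup>2) \<longlonglongrightarrow> 16 / 3 * (0 * 0) + 16 / 9 * (C * 0)\<^sup>2"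
      by (intro tendsto_intros mu0 eps_lim)
    then have "(\<lambda>k. (norm (r k))\<^sup>2) \<longlonglongrightarrow> 0"
      using bound by (intro Lim_null_comparison[where f = "\<lambda>k. (norm (r k))\<^sup>2"]) auto
    from tendsto_real_sqrt[OF this] show ?thesis
      by (simp add: tendsto_norm_zero_iff)
  next
    assume "multiplier_set f g c \<inter> S \<noteq> {}"
    then obtain p where p: "p \<in> multipliers f g c xs" and pS: "p \<in> S"
      unfolding multiplier_set_eq[OF P xs] by blast
    define d where "d k = y (Suc k) - yhat k" for k
    have r_d: "r k = \<mu> k *\<^sub>R d k" for k
    proof -
      have "y (Suc k) = yhat k + inverse (\<mu> k) *\<^sub>R (c (x k) - z k)" using ALM by blast
      then show ?thesis using mu_pos[of k] by (simp add: d_def r_def)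
    qed
    \<comment> \<open>Dividing the estimate by \<open>\<mu> k\<close> and doubling gives
      \<open>3 / 2\<close> times the square of \<open>norm (d k)\<close>; expanding the square of
      \<open>norm (y (Suc k) - p)\<close> uses up 1, and 1/2 remains.\<close>
    have descent: "(norm (y (Suc k) - p))\<^sup>2 + (norm (d k))\<^sup>2 / 2
        \<le> (norm (y k - p))\<^sup>2 + 4 * (\<epsilon> k / \<mu> k)" for k
    proof -
      have "r k \<bullet> (yhat k - p) + 3 / 4 * (norm (r k))\<^sup>2 / \<mu> k \<le> 2 * \<epsilon> k"
        using step[OF p, of k] by blast
      moreover have "r k \<bullet> (yhat k - p) + 3 / 4 * (norm (r k))\<^sup>2 / \<mu> k =
          \<mu> k * (d k \<bullet> (yhat k - p) + 3 / 4 * (norm (d k))\<^sup>2)"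
        using mu_pos[of k] by (simp add: r_d power_mult_distrib power2_eq_square field_simps)
      ultimately have "\<mu> k * (d k \<bullet> (yhat k - p) + 3 / 4 * (norm (d k))\<^sup>2) \<le> 2 * \<epsilon> k"
        by metis
      then have "d k \<bullet> (yhat k - p) + 3 / 4 * (norm (d k))\<^sup>2 \<le> 2 * \<epsilon> k / \<mu> k"
        using mu_pos[of k] by (simp add: pos_le_divide_eq mult.commute)
      then have "d k \<bullet> (yhat k - p) + 3 / 4 * (norm (d k))\<^sup>2 \<le> 2 * (\<epsilon> k / \<mu> k)"
        by simp
      moreover have "(norm (y (Suc k) - p))\<^sup>2 =
          (norm (yhat k - p))\<^sup>2 + 2 * (d k \<bullet> (yhat k - p)) + (norm (d k))\<^sup>2"
      proof -
        have *: "y (Suc k) - p = (yhat k - p) + d k" by (simp add: d_def)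
        show ?thesis
          unfolding * power2_norm_eq_inner inner_add_left inner_add_right by (simp add: inner_commute)
      qed
      \<comment> \<open>The projection onto \<open>S\<close> is nonexpansive and fixes
        \<open>p\<close>, because \<open>p \<in> S\<close>.\<close>
      moreover have "(norm (yhat k - p))\<^sup>2 \<le> (norm (y k - p))\<^sup>2"
      proof -
        have "yhat k = closest_point S (y k)" using ALM by blast
        then show ?thesis
          using closest_point_lipschitz[OF S(2,3,1), of "y k" p] closest_point_self[OF pS]
          by (simp add: dist_norm power_mono)
      qed
      ultimately show ?thesis by argo
    qed
    have "summable (\<lambda>k. (norm (d k))\<^sup>2 / 2)"
    proof (rule summable_of_descent[where a = "\<lambda>k. (norm (y k - p))\<^sup>2"
          and b = "\<lambda>k. 4 * (\<epsilon> k / \<mu> k)", OF descent])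
      show "0 \<le> 4 * (\<epsilon> k / \<mu> k)" for k
        using divide_nonneg_pos[OF eps mu_pos, of k k] by linarith
      show "summable (\<lambda>k. 4 * (\<epsilon> k / \<mu> k))"
        by (rule summable_mult[OF sum_em])
    qed simp_all
    from tendsto_mult_right_zero[OF summable_LIMSEQ_zero[OF this], of 2]
    have "(\<lambda>k. (norm (d k))\<^sup>2) \<longlonglongrightarrow> 0" by simp
    from tendsto_real_sqrt[OF this] have d_lim: "(\<lambda>k. norm (d k)) \<longlonglongrightarrow> 0" by simp
    show ?thesis
    proof (rule Lim_null_comparison)
      show "(\<lambda>k. \<mu>0 * norm (d k)) \<longlonglongrightarrow> 0"
        by (rule tendsto_mult_right_zero[OF d_lim])
      have "norm (r k) \<le> \<mu>0 * norm (d k)" for k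
        unfolding r_d using mu_pos[of k] mu_le[of k] by (simp add: mult_right_mono)
      then show "eventually (\<lambda>k. norm (r k) \<le> \<mu>0 * norm (d k)) sequentially" by simp
    qed
  qed
  \<comment> \<open>The excess over \<open>\<phi>\<close> once the nonnegative penalty is dropped
    and the multiplier term is bounded through \<open>norm (yhat k) \<le> B\<close>.\<close>
  define \<delta> where "\<delta> k = \<epsilon> k + B * norm (r k)" for k
  have \<delta>: "\<delta> \<longlonglongrightarrow> 0"
    unfolding \<delta>_def using tendsto_add[OF eps_lim tendsto_mult_right_zero[OF tendsto_norm_zero[OF r_lim]]]
    by simp
  have F_le: "ereal (f (x k)) + g (z k) \<le> ereal (\<phi> + \<delta> k)" for k
  proof -
    obtain G where G: "g (z k) = ereal G"
      and le: "f (x k) + G + r k \<bullet> yhat k + (norm (r k))\<^sup>2 / (2 * \<mu> k) \<le> \<phi> + \<epsilon> k"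
      using step[OF p0, of k] by blast
    have "- (r k \<bullet> yhat k) \<le> norm (yhat k) * norm (r k)"
      using Cauchy_Schwarz_ineq2[of "r k" "yhat k"] by (simp add: mult.commute)
    also have "\<dots> \<le> B * norm (r k)"
      by (intro mult_right_mono B yS) simp
    finally have "- (r k \<bullet> yhat k) \<le> B * norm (r k)" .
    moreover have "0 \<le> (norm (r k))\<^sup>2 / (2 * \<mu> k)"
      using mu_pos[of k] by simp
    ultimately have "f (x k) + G \<le> \<phi> + \<delta> k"
      using le unfolding \<delta>_def by linarith
    then show ?thesis by (simp add: G)
  qed
  \<comment> \<open>Stated along any \<open>s\<close> tending to infinity, to cover both the full
    sequence and its subsequences.\<close>
  have F_limsup: "limsup (\<lambda>k. ereal (f (x (s k))) + g (z (s k))) \<le> min_value f g c"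
    if s: "filterlim s sequentially sequentially" for s :: "nat \<Rightarrow> nat"
  proof -
    have "(\<lambda>k. \<phi> + \<delta> (s k)) \<longlonglongrightarrow> \<phi> + 0"
      by (intro tendsto_intros filterlim_compose[OF \<delta> s])
    then have "limsup (\<lambda>k. ereal (\<phi> + \<delta> (s k))) = ereal \<phi>"
      by (intro lim_imp_Limsup) auto
    moreover have "limsup (\<lambda>k. ereal (f (x (s k))) + g (z (s k))) \<le> limsup (\<lambda>k. ereal (\<phi> + \<delta> (s k)))"
      by (intro Limsup_mono always_eventually allI F_le)
    ultimately show ?thesis by (simp add: \<phi>)
  qed
  have subseq: "is_minimizer f g c xbar \<and> (z \<circ> s) \<longlonglongrightarrow> c xbar \<and>
      (\<lambda>k. ereal (f (x (s k))) + g (z (s k))) \<longlonglongrightarrow> min_value f g c"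
    if s: "strict_mono s" and lim: "(x \<circ> s) \<longlonglongrightarrow> xbar" for s xbar
  proof -
    have cont: "isCont f xbar" "isCont c xbar"
      using P has_derivative_continuous
      unfolding composite_problem_def continuously_differentiable_def by blast+
    have x_lim: "(\<lambda>k. x (s k)) \<longlonglongrightarrow> xbar"
      using lim by (simp add: o_def)
    have s_lim: "filterlim s sequentially sequentially"
      by (rule filterlim_subseq[OF s])
    have "(\<lambda>k. c (x (s k)) - r (s k)) \<longlonglongrightarrow> c xbar - 0"
      by (intro tendsto_diff isCont_tendsto_compose[OF cont(2)] x_lim filterlim_compose[OF r_lim s_lim])
    then have z_lim: "(\<lambda>k. z (s k)) \<longlonglongrightarrow> c xbar"
      by (simp add: r_def)
    have f_lim: "(\<lambda>k. f (x (s k))) \<longlonglongrightarrow> f xbar"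
      by (rule isCont_tendsto_compose[OF cont(1) x_lim])
    let ?F = "\<lambda>k. ereal (f (x (s k))) + g (z (s k))"
    have g_lim: "g (c xbar) \<le> liminf (\<lambda>k. g (z (s k)))"
      using P by (intro lsc_le_liminf z_lim) (simp add: composite_problem_def)
    \<comment> \<open>The finite limit of the \<open>f\<close> part splits off, so lower
      semicontinuity of \<open>g\<close> bounds the liminf of the sum from below.\<close>
    have "liminf ?F = ereal (f xbar) + liminf (\<lambda>k. g (z (s k)))"
      using f_lim by (intro ereal_liminf_lim_add) auto
    with g_lim have low: "objective f g c xbar \<le> liminf ?F"
      unfolding objective_def by (simp add: add_left_mono)
    have up: "limsup ?F \<le> min_value f g c" by (rule F_limsup[OF s_lim])
    have mid: "liminf ?F \<le> limsup ?F" by (rule Liminf_le_Limsup) simp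
    from low mid up have le: "objective f g c xbar \<le> min_value f g c" by order
    have ge: "min_value f g c \<le> objective f g c xbar"
      unfolding min_value_def by (rule INF_lower) simp
    \<comment> \<open>The chain from \<open>min_value f g c\<close> through the objective at
      \<open>xbar\<close>, liminf and limsup returns to \<open>min_value f g c\<close>, so all of
      these are equal.\<close>
    have "?F \<longlonglongrightarrow> min_value f g c"
      using ge low mid up by (intro Liminf_eq_Limsup) (simp, order+)
    moreover have "is_minimizer f g c xbar"
      by (rule is_minimizer_if_le_min_value[OF P le])
    ultimately show ?thesis using z_lim by (simp add: o_def)
  qed
  have "limsup (\<lambda>k. ereal (f (x k)) + g (z k)) \<le> min_value f g c"
    by (rule F_limsup[OF filterlim_ident])
  moreover have "(\<lambda>k. c (x k) - z k) \<longlonglongrightarrow> 0"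
    using r_lim by (simp add: r_def[abs_def])
  ultimately show ?thesis using subseq by blast
qed

end
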